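(* Let $0\le k\le n-2$. An $n$-element poset $P$ has a $k$-untangled labeling if and only if $P$ has a lower order ideal of size $k+2$ that is not an antichain.
   Context: A labeling of a finite $n$-element poset $P$ is a bijection $L:P\to[n]$; a linear extension is a labeling with $L(x)\le L(y)$ whenever $x\le_P y$. A lower order ideal of $P$ is a subset $Q$ such that $x\in Q$ and $x'\le_P x$ imply $x'\in Q$. For a labeling $L$ and a non-maximal $x\in P$, the $L$-successor of $x$ is the element $y>_P x$ minimizing $L(y)$. The promotion chain of $L$ is $v_1<_P\cdots<_P v_m$, where $v_1=L^{-1}(1)$, $v_{i+1}$ is the $L$-successor of $v_i$ as long as $v_i$ is not maximal, and $v_m$ is maximal. Extended promotion is defined by $\partial(L)(x)=L(x)-1$ if $x$ is not in the promotion chain, $\partial(L)(v_i)=L(v_{i+1})-1$ for $1\le i\le m-1$, and $\partial(L)(v_m)=n$. A labeling $L$ of an $n$-element poset is $k$-untangled if $n\ge k+2$ and $\partial^{n-k-2}(L)$ is not a linear extension. *)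

theory Defs
  imports Main
begin

text \<open>
  A finite poset is a finite carrier \<open>P\<close> together with a relation \<open>r\<close> satisfying
  \<^term>\<open>partial_order_on P r\<close>, where \<^term>\<open>(x, y) \<in> r\<close> means \<open>x \<le>\<^sub>P y\<close>.
  Labelings are functions \<^typ>\<open>'a \<Rightarrow> nat\<close> of which only the values on \<open>P\<close> matter.
\<close>

definition labeling :: "'a set \<Rightarrow> ('a \<Rightarrow> nat) \<Rightarrow> bool" where
  "labeling P L \<longleftrightarrow> bij_betw L P {1..card P}"

definition linear_extension :: "'a set \<Rightarrow> 'a rel \<Rightarrow> ('a \<Rightarrow> nat) \<Rightarrow> bool" where
  "linear_extension P r L \<longleftrightarrow>
     labeling P L \<and> (\<forall>x\<in>P. \<forall>y\<in>P. (x, y) \<in> r \<longrightarrow> L x \<le> L y)"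

definition lower_order_ideal :: "'a set \<Rightarrow> 'a rel \<Rightarrow> 'a set \<Rightarrow> bool" where
  "lower_order_ideal P r Q \<longleftrightarrow>
     Q \<subseteq> P \<and> (\<forall>x\<in>Q. \<forall>x'\<in>P. (x', x) \<in> r \<longrightarrow> x' \<in> Q)"

definition antichain :: "'a rel \<Rightarrow> 'a set \<Rightarrow> bool" where
  "antichain r Q \<longleftrightarrow> (\<forall>x\<in>Q. \<forall>y\<in>Q. (x, y) \<in> r \<longrightarrow> x = y)"

definition maximal_element :: "'a set \<Rightarrow> 'a rel \<Rightarrow> 'a \<Rightarrow> bool" where
  "maximal_element P r x \<longleftrightarrow> x \<in> P \<and> \<not> (\<exists>y\<in>P. (x, y) \<in> r \<and> y \<noteq> x)"

text \<open>Meaningful only if \<open>x\<close> is not maximal; \<^term>\<open>aboveS r x\<close> is \<open>{y. y >\<^sub>P x}\<close>.\<close>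

definition successor :: "'a rel \<Rightarrow> ('a \<Rightarrow> nat) \<Rightarrow> 'a \<Rightarrow> 'a" where
  "successor r L x = arg_min_on L (aboveS r x)"

text \<open>
  The set \<open>{v\<^sub>1, \<dots>, v\<^sub>m}\<close> of elements of the promotion chain. The indices are not
  recorded: \<open>v\<^sub>m\<close> is the only maximal element in it, and \<open>v\<^sub>i\<^sub>+\<^sub>1\<close> is the successor of
  \<open>v\<^sub>i\<close>.
\<close>

inductive_set promotion_chain :: "'a set \<Rightarrow> 'a rel \<Rightarrow> ('a \<Rightarrow> nat) \<Rightarrow> 'a set"
  for P :: "'a set" and r :: "'a rel" and L :: "'a \<Rightarrow> nat" where
  first: "inv_into P L 1 \<in> promotion_chain P r L"
| step: "\<lbrakk>v \<in> promotion_chain P r L; \<not> maximal_element P r v\<rbrakk>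
    \<Longrightarrow> successor r L v \<in> promotion_chain P r L"

definition promotion :: "'a set \<Rightarrow> 'a rel \<Rightarrow> ('a \<Rightarrow> nat) \<Rightarrow> 'a \<Rightarrow> nat" where
  "promotion P r L x =
     (if x \<notin> promotion_chain P r L then L x - 1
      else if \<not> maximal_element P r x then L (successor r L x) - 1
      else card P)"

definition untangled :: "'a set \<Rightarrow> 'a rel \<Rightarrow> nat \<Rightarrow> ('a \<Rightarrow> nat) \<Rightarrow> bool" where
  "untangled P r k L \<longleftrightarrow>
     labeling P L \<and> k + 2 \<le> card P \<and>
     \<not> linear_extension P r ((promotion P r ^^ (card P - k - 2)) L)"

end

theory Submission
  imports Defs
begin

text \<open>
  If the labels above \<open>b\<close> occupy an upper order ideal, then after one promotion so do the labels
  from \<open>b\<close> on. Hence after \<open>n - k - 2\<close> promotions the labels \<open>1, \<dots>, k + 2\<close> occupy a lower order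
  ideal, and every remaining inversion lies inside it. Conversely, given a lower order ideal \<open>Q\<close> of
  size \<open>k + 2\<close> with \<open>x < y\<close> in it, give \<open>Q\<close> the \<open>k + 2\<close> largest labels so that \<open>x\<close> and \<open>y\<close> are
  inverted. The first \<open>n - k - 2\<close> promotion chains start outside \<open>Q\<close> and so stay outside it;
  they merely lower all labels on \<open>Q\<close> by one, and the inversion survives.
\<close>

context
  fixes P :: "'a set" and r :: "'a rel"
  assumes finite_P: "finite P" and order_P: "partial_order_on P r"
begin

section \<open>Order axioms and successors\<close>

lemma order_in: "(x, y) \<in> r \<Longrightarrow> x \<in> P \<and> y \<in> P"
  using order_P by (auto simp: partial_order_on_def preorder_on_def)

lemma order_refl: "x \<in> P \<Longrightarrow> (x, x) \<in> r"
  using order_P by (auto simp: partial_order_on_def preorder_on_def refl_on_def)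

lemma order_trans: "(x, y) \<in> r \<Longrightarrow> (y, z) \<in> r \<Longrightarrow> (x, z) \<in> r"
  using order_P by (auto simp: partial_order_on_def preorder_on_def dest: transD)

lemma order_antisym: "(x, y) \<in> r \<Longrightarrow> (y, x) \<in> r \<Longrightarrow> x = y"
  using order_P by (auto simp: partial_order_on_def dest: antisymD)

lemma finite_aboveS: "finite (aboveS r x)"
  using order_in by (intro finite_subset[OF _ finite_P]) (auto simp: aboveS_def)

lemma successor_above:
  assumes "x \<in> P" "\<not> maximal_element P r x"
  shows "(x, successor r L x) \<in> r" "successor r L x \<noteq> x"
proof -
  have "aboveS r x \<noteq> {}"
    using assms by (auto simp: maximal_element_def aboveS_def)
  then have "successor r L x \<in> aboveS r x"
    unfolding successor_def by (intro arg_min_if_finite(1)[OF finite_aboveS])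
  then show "(x, successor r L x) \<in> r" "successor r L x \<noteq> x"
    by (auto simp: aboveS_def)
qed

lemma successor_le:
  assumes "(x, y) \<in> r" "x \<noteq> y"
  shows "L (successor r L x) \<le> L y"
proof -
  have "y \<in> aboveS r x"
    using assms by (auto simp: aboveS_def)
  then show ?thesis
    unfolding successor_def by (intro arg_min_least[OF finite_aboveS]) auto
qed

section \<open>Structure of the promotion chain\<close>

text \<open>\<open>inv_into P L 1\<close> is unspecified when no element of \<open>P\<close> has
  label 1; assuming that it lies in \<open>P\<close> stands in for the labeling property.\<close>

lemma promotion_chain_in:
  assumes "v \<in> promotion_chain P r L" "inv_into P L 1 \<in> P"
  shows "v \<in> P"
  using assms
proof (induction rule: promotion_chain.induct)
  case (step v)
  then show ?case using successor_above(1) order_in by blast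
qed

text \<open>The set \<open>promotion_chain\<close> forgets the order of its elements; iterating this
  functional relation recovers it.\<close>

definition chain_step :: "('a \<Rightarrow> nat) \<Rightarrow> 'a rel" where
  "chain_step L = {(v, successor r L v) | v. v \<in> P \<and> \<not> maximal_element P r v}"

lemma chain_step_rtrancl_order:
  assumes "(u, v) \<in> (chain_step L)\<^sup>*" "u \<in> P"
  shows "(u, v) \<in> r"
  using assms
proof (induction rule: rtrancl_induct)
  case base
  then show ?case by (rule order_refl)
next
  case (step y z)
  then show ?case
    using successor_above(1) order_trans by (auto simp: chain_step_def)
qed

lemma promotion_chain_reachable:
  assumes "v \<in> promotion_chain P r L" "inv_into P L 1 \<in> P"
  shows "(inv_into P L 1, v) \<in> (chain_step L)\<^sup>*"
  using assms
proof (induction rule: promotion_chain.induct)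
  case (step v)
  then have "(v, successor r L v) \<in> chain_step L"
    using promotion_chain_in by (auto simp: chain_step_def)
  with step show ?case by (meson rtrancl.rtrancl_into_rtrancl)
qed simp

text \<open>\<open>chain_step\<close> is single-valued, so of two elements reachable from the same
  start one is reachable from the other, and a nontrivial path begins with the step to the
  successor. This sharpening of comparability yields both uniqueness of the maximal element and
  injectivity of successors along the chain.\<close>

lemma promotion_chain_total:
  assumes "u \<in> promotion_chain P r L" "v \<in> promotion_chain P r L" "inv_into P L 1 \<in> P" "u \<noteq> v"
  shows "(\<not> maximal_element P r u \<and> (successor r L u, v) \<in> r) \<or>
         (\<not> maximal_element P r v \<and> (successor r L v, u) \<in> r)"
proof -
  have *: "\<not> maximal_element P r x \<and> (successor r L x, y) \<in> r"
    if "(x, y) \<in> (chain_step L)\<^sup>*" "x \<noteq> y" for x y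
  proof -
    from that obtain z where z: "(x, z) \<in> chain_step L" "(z, y) \<in> (chain_step L)\<^sup>*"
      by (meson converse_rtranclE)
    then have "z \<in> P"
      using successor_above(1) order_in by (auto simp: chain_step_def)
    with z show ?thesis
      using chain_step_rtrancl_order by (auto simp: chain_step_def)
  qed
  have "single_valued (chain_step L)"
    by (auto simp: single_valued_def chain_step_def)
  then have "(u, v) \<in> (chain_step L)\<^sup>* \<or> (v, u) \<in> (chain_step L)\<^sup>*"
    using assms promotion_chain_reachable single_valued_confluent by metis
  then show ?thesis
    using * assms(4) by metis
qed

text \<open>Otherwise, up to symmetry, the successor of \<open>u\<close> is \<le> \<open>v\<close>,
  which is strictly below its own successor, the same element.\<close>

lemma successor_inj_promotion_chain:
  assumes "u \<in> promotion_chain P r L" "v \<in> promotion_chain P r L" "inv_into P L 1 \<in> P"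
    and "\<not> maximal_element P r u" "\<not> maximal_element P r v"
    and "successor r L u = successor r L v"
  shows "u = v"
  using assms promotion_chain_total promotion_chain_in successor_above order_antisym by metis

section \<open>Promotion preserves labelings\<close>

lemma labeling_first_in:
  assumes "labeling P L" "P \<noteq> {}"
  shows "inv_into P L 1 \<in> P" "L (inv_into P L 1) = 1"
proof -
  have "1 \<in> L ` P"
    using assms finite_P by (auto simp: labeling_def bij_betw_def Suc_le_eq card_gt_0_iff)
  then show "inv_into P L 1 \<in> P" "L (inv_into P L 1) = 1"
    by (auto intro: inv_into_into f_inv_into_f)
qed

text \<open>An injective map from \<open>P\<close> into \<open>{1..card P}\<close> is onto by
  counting. Injectivity compares the three cases of \<open>promotion\<close> with one
  another.\<close>

lemma labeling_promotion:
  assumes L: "labeling P L"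
  shows "labeling P (promotion P r L)"
proof (cases "P = {}")
  case True
  then show ?thesis by (simp add: labeling_def bij_betw_def)
next
  case False
  note first = labeling_first_in[OF L False]
  let ?C = "promotion_chain P r L"
  have inj: "inj_on L P" and range: "\<And>x. x \<in> P \<Longrightarrow> 1 \<le> L x \<and> L x \<le> card P"
    using L by (auto simp: labeling_def bij_betw_def)
  \<comment> \<open>The bound 2 keeps the lowered labels positive and makes truncated subtraction of
    1 injective.\<close>
  have not1: "2 \<le> L x" if "x \<in> P" "x \<noteq> inv_into P L 1" for x
    using range[OF that(1)] inj_onD[OF inj, of x "inv_into P L 1"] first that by fastforce
  have succ_in: "successor r L x \<in> P" if "x \<in> P" "\<not> maximal_element P r x" for x
    using successor_above(1)[OF that] order_in by blast
  have chain_not1: "2 \<le> L (successor r L x)" if "x \<in> ?C" "\<not> maximal_element P r x" for x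
  proof -
    have x: "x \<in> P" using that promotion_chain_in first by blast
    have "(inv_into P L 1, x) \<in> r"
      using chain_step_rtrancl_order promotion_chain_reachable that first by blast
    then have "successor r L x \<noteq> inv_into P L 1"
      using successor_above[OF x that(2)] order_antisym by metis
    then show ?thesis using not1 succ_in x that(2) by blast
  qed
  have nonchain: "2 \<le> L x" if "x \<in> P" "x \<notin> ?C" for x
    using not1 that promotion_chain.first by metis
  have "inj_on (promotion P r L) P"
  proof (rule inj_onI)
    \<comment> \<open>Off the chain the new label is below \<open>card P\<close>, so it differs from
      that of a maximal chain element; agreement with a non-maximal \<open>y\<close> would make
      \<open>x\<close> the successor of \<open>y\<close>, hence a chain element.\<close>
    have *: "x \<in> ?C" if "x \<in> P" "y \<in> P" "y \<in> ?C" "promotion P r L x = promotion P r L y" for x y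
    proof (rule ccontr)
      assume x: "x \<notin> ?C"
      show False
      proof (cases "maximal_element P r y")
        case True
        then show False using that x nonchain[of x] range[of x] by (auto simp: promotion_def)
      next
        case False
        then have "L x = L (successor r L y)"
          using that x nonchain[of x] chain_not1[of y] by (auto simp: promotion_def)
        then have "x = successor r L y"
          using inj_onD[OF inj] succ_in that(1,2) False by blast
        then show False using x False that(3) promotion_chain.step by metis
      qed
    qed
    have max: "\<not> maximal_element P r y" if "x \<in> ?C" "y \<in> ?C" "\<not> maximal_element P r x"
      and "x \<in> P" "y \<in> P" "promotion P r L x = promotion P r L y" for x y
      using that chain_not1[of x] range[OF succ_in[of x]] by (auto simp: promotion_def)
    fix x y assume xy: "x \<in> P" "y \<in> P" and eq: "promotion P r L x = promotion P r L y"
    consider "x \<notin> ?C" "y \<notin> ?C"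
      | "x \<in> ?C" "y \<in> ?C" "\<not> maximal_element P r x" "\<not> maximal_element P r y"
      | "x \<in> ?C" "y \<in> ?C" "maximal_element P r x" "maximal_element P r y"
      using * max xy eq by metis
    then show "x = y"
    proof cases
      case 1
      then have "L x = L y"
        using eq nonchain[of x] nonchain[of y] xy by (auto simp: promotion_def)
      then show ?thesis using inj_onD[OF inj] xy by blast
    next
      case 2
      then have "L (successor r L x) = L (successor r L y)"
        using eq chain_not1[of x] chain_not1[of y] by (auto simp: promotion_def)
      then have "successor r L x = successor r L y"
        using inj_onD[OF inj] succ_in xy 2 by blast
      then show ?thesis using successor_inj_promotion_chain 2 first(1) by blast
    next
      case 3
      then show ?thesis using promotion_chain_total first(1) by blast
    qed
  qed
  moreover have "promotion P r L x \<in> {1..card P}" if "x \<in> P" for x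
    using that nonchain[of x] chain_not1[of x] range[of x] range[OF succ_in[of x]]
    by (auto simp: promotion_def)
  ultimately show ?thesis
    unfolding labeling_def bij_betw_def
    by (intro conjI card_subset_eq) (auto simp: card_image)
qed

lemma labeling_funpow_promotion:
  "labeling P L \<Longrightarrow> labeling P ((promotion P r ^^ j) L)"
  by (induction j) (auto intro: labeling_promotion)

section \<open>From an untangled labeling to an ideal\<close>

text \<open>The quantifiers may range over the whole type because \<open>r\<close> relates only
  elements of \<open>P\<close>.\<close>

definition upper_from :: "('a \<Rightarrow> nat) \<Rightarrow> nat \<Rightarrow> bool" where
  "upper_from L b \<longleftrightarrow> (\<forall>x y. (x, y) \<in> r \<longrightarrow> b \<le> L x \<longrightarrow> b \<le> L y)"

lemma upper_from_card_less:
  assumes "labeling P L" "card P < b"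
  shows "upper_from L b"
proof -
  have "L x < b" if "x \<in> P" for x
    using assms that bij_betwE[of L P] by (fastforce simp: labeling_def)
  then show ?thesis
    using order_in unfolding upper_from_def by (meson not_le)
qed

text \<open>For \<open>x\<close> strictly below \<open>y\<close>, the new label of \<open>x\<close>
  comes from \<open>x\<close> or from its successor, whose label is least above \<open>x\<close>;
  either way \<open>y\<close> had label at least \<open>Suc b\<close>. The new label of
  \<open>y\<close> comes from \<open>y\<close>, from an element above it, or is
  \<open>card P\<close>.\<close>

lemma upper_from_promotion:
  assumes "upper_from L (Suc b)" "1 \<le> b" "b \<le> card P"
  shows "upper_from (promotion P r L) b"
  unfolding upper_from_def
proof (intro allI impI)
  fix x y assume xy: "(x, y) \<in> r" and x: "b \<le> promotion P r L x"
  show "b \<le> promotion P r L y"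
  proof (cases "x = y")
    case False
    have "\<not> maximal_element P r x"
      using xy False order_in by (auto simp: maximal_element_def)
    moreover have "Suc b \<le> L y" if "Suc b \<le> L x"
      using assms(1) that xy unfolding upper_from_def by blast
    ultimately have y: "Suc b \<le> L y"
      using x successor_le[OF xy False, of L] assms(2) by (auto simp: promotion_def split: if_splits)
    have "Suc b \<le> L (successor r L y)" if "\<not> maximal_element P r y"
      using successor_above(1)[OF _ that] xy order_in y assms(1) unfolding upper_from_def by blast
    then show ?thesis
      using y assms(3) by (auto simp: promotion_def)
  qed (use x in simp)
qed

text \<open>Each promotion lowers the threshold by one, so the induction varies \<open>b\<close> and
  uses the hypothesis at \<open>Suc b\<close>.\<close>

lemma upper_from_funpow_promotion:
  assumes "labeling P L" "j \<le> card P" "card P - j < b"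
  shows "upper_from ((promotion P r ^^ j) L) b"
  using assms(2,3)
proof (induction j arbitrary: b)
  case 0
  then show ?case
    using upper_from_card_less[OF assms(1)] by simp
next
  case (Suc j)
  show ?case
  proof (cases "b \<le> card P")
    case True
    with Suc.prems Suc.IH[of "Suc b"] show ?thesis
      by (auto intro!: upper_from_promotion)
  next
    case False
    then show ?thesis
      by (intro upper_from_card_less[OF labeling_funpow_promotion[OF assms(1)]]) simp
  qed
qed

lemma untangled_imp_ideal:
  assumes "untangled P r k L"
  shows "\<exists>Q. lower_order_ideal P r Q \<and> card Q = k + 2 \<and> \<not> antichain r Q"
proof -
  define M where "M = (promotion P r ^^ (card P - k - 2)) L"
  define Q where "Q = {x \<in> P. M x \<le> k + 2}"
  have L: "labeling P L" and k: "k + 2 \<le> card P" and nle: "\<not> linear_extension P r M"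
    using assms by (auto simp: untangled_def M_def)
  have M: "labeling P M"
    unfolding M_def by (rule labeling_funpow_promotion[OF L])
  \<comment> \<open>Here \<open>card P - j\<close> is \<open>k + 2\<close>. The threshold
    \<open>k + 3\<close> makes \<open>Q\<close> an ideal; the higher ones locate the
    inversion.\<close>
  have up: "upper_from M b" if "k + 2 < b" for b
    unfolding M_def using that k by (intro upper_from_funpow_promotion[OF L]) auto
  have "lower_order_ideal P r Q"
    using up[of "k + 3"] by (fastforce simp: lower_order_ideal_def Q_def upper_from_def)
  moreover have "card Q = k + 2"
  proof -
    have img: "M ` P = {1..card P}" and inj: "inj_on M P"
      using M by (auto simp: labeling_def bij_betw_def)
    have "M ` Q = M ` P \<inter> {..k + 2}"
      by (auto simp: Q_def)
    also have "\<dots> = {1..k + 2}"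
      using k unfolding img by auto
    finally show ?thesis
      using card_image[of M Q] inj_on_subset[OF inj, of Q] by (auto simp: Q_def)
  qed
  moreover have "\<not> antichain r Q"
  proof -
    obtain x y where xy: "x \<in> P" "y \<in> P" "(x, y) \<in> r" "M y < M x"
      using nle M by (auto simp: linear_extension_def not_le)
    \<comment> \<open>Otherwise the threshold \<open>M x\<close> itself would force
      \<open>M x \<le> M y\<close>.\<close>
    have "M x \<le> k + 2"
      using up[of "M x"] xy by (fastforce simp: upper_from_def)
    with xy show ?thesis
      by (force simp: antichain_def Q_def)
  qed
  ultimately show ?thesis by blast
qed

section \<open>From an ideal to an untangled labeling\<close>

text \<open>The complement of \<open>Q\<close> is closed upwards and successors go up, so the chain
  never enters \<open>Q\<close>.\<close>

lemma promotion_lower_order_ideal: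
  assumes "lower_order_ideal P r Q" "inv_into P L 1 \<in> P - Q" "x \<in> Q"
  shows "promotion P r L x = L x - 1"
proof -
  have "v \<in> P - Q" if "v \<in> promotion_chain P r L" for v
    using that
  proof (induction rule: promotion_chain.induct)
    case (step v)
    then have "(v, successor r L v) \<in> r"
      using successor_above by blast
    with step show ?case
      using assms(1) order_in unfolding lower_order_ideal_def by blast
  qed (rule assms(2))
  then show ?thesis
    using assms(3) by (auto simp: promotion_def)
qed

lemma funpow_promotion_lower_order_ideal:
  assumes "labeling P L" "lower_order_ideal P r Q" "\<And>x. x \<in> Q \<Longrightarrow> m < L x" "j \<le> m" "x \<in> Q"
  shows "(promotion P r ^^ j) L x = L x - j"
  using assms(4,5)
proof (induction j arbitrary: x)
  case (Suc j)
  define M where "M = (promotion P r ^^ j) L"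
  have M: "M z = L z - j" if "z \<in> Q" for z
    using Suc that by (simp add: M_def)
  have "labeling P M"
    unfolding M_def using assms(1) by (rule labeling_funpow_promotion)
  moreover have "P \<noteq> {}"
    using Suc.prems assms(2) by (auto simp: lower_order_ideal_def)
  ultimately have first: "inv_into P M 1 \<in> P" "M (inv_into P M 1) = 1"
    by (rule labeling_first_in)+
  \<comment> \<open>As \<open>Suc j \<le> m\<close>, every label \<open>L z - j\<close> on
    \<open>Q\<close> is at least 2.\<close>
  have "inv_into P M 1 \<notin> Q"
  proof
    assume "inv_into P M 1 \<in> Q"
    with first(2) M assms(3)[of "inv_into P M 1"] Suc.prems(1) show False by auto
  qed
  then have "promotion P r M x = M x - 1"
    using first(1) Suc.prems(2) by (intro promotion_lower_order_ideal[OF assms(2)]) auto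
  then show ?case
    using M[OF Suc.prems(2)] by (simp add: M_def)
qed simp

end

text \<open>If an arbitrary bijection does not invert the pair, composing it with the reversal of
  the interval does.\<close>

lemma ex_bij_betw_inverting:
  fixes a b :: nat
  assumes "finite Q" "card Q = b - a" "a \<le> b" "x \<in> Q" "y \<in> Q" "x \<noteq> y"
  obtains g where "bij_betw g Q {Suc a..b}" "g y < g x"
proof -
  obtain g where g: "bij_betw g Q {Suc a..b}"
    using finite_same_card_bij[of Q "{Suc a..b}"] assms by auto
  have "g x \<noteq> g y"
    using g assms by (auto simp: bij_betw_def dest: inj_onD)
  moreover have "bij_betw (\<lambda>i. Suc (a + b) - i) {Suc a..b} {Suc a..b}"
    by (rule bij_betw_byWitness[where f' = "\<lambda>i. Suc (a + b) - i"]) auto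
  then have "bij_betw ((\<lambda>i. Suc (a + b) - i) \<circ> g) Q {Suc a..b}"
    using g bij_betw_trans by blast
  moreover have "g x \<le> b" "g y \<le> b"
    using g assms by (auto simp: bij_betw_def)
  then have "Suc (a + b) - g y < Suc (a + b) - g x" if "g x < g y"
    using that by auto
  ultimately show ?thesis
    using that[of g] that[of "(\<lambda>i. Suc (a + b) - i) \<circ> g"] g by (cases "g x < g y") auto
qed

lemma ideal_imp_untangled:
  assumes P: "finite P" "partial_order_on P r" and k: "k + 2 \<le> card P"
    and Q: "lower_order_ideal P r Q" "card Q = k + 2" "\<not> antichain r Q"
  shows "\<exists>L. untangled P r k L"
proof -
  \<comment> \<open>Both the number of promotions in \<open>untangled\<close> and the number of
    elements outside \<open>Q\<close>.\<close>
  define m where "m = card P - k - 2"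
  have QP: "Q \<subseteq> P" and finQ: "finite Q"
    using Q(1) P(1) by (auto simp: lower_order_ideal_def intro: finite_subset)
  obtain x y where xy: "x \<in> Q" "y \<in> Q" "(x, y) \<in> r" "x \<noteq> y"
    using Q(3) by (auto simp: antichain_def)
  obtain g where g: "bij_betw g Q {Suc m..card P}" "g y < g x"
    using ex_bij_betw_inverting[of Q "card P" m x y] finQ Q(2) k xy by (auto simp: m_def)
  have "card (P - Q) = m"
    using card_Diff_subset[OF finQ QP] Q(2) by (simp add: m_def)
  then obtain f where f: "bij_betw f (P - Q) {1..m}"
    using finite_same_card_bij[of "P - Q" "{1..m}"] P(1) by auto
  define L where "L z = (if z \<in> Q then g z else f z)" for z
  have "bij_betw L (Q \<union> (P - Q)) ({Suc m..card P} \<union> {1..m})"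
    unfolding L_def using bij_betw_disjoint_Un[OF g(1) f] by auto
  moreover have "Q \<union> (P - Q) = P" "{Suc m..card P} \<union> {1..m} = {1..card P}"
    using QP k by (auto simp: m_def)
  ultimately have L: "labeling P L"
    by (simp add: labeling_def)
  have Lm: "m < L z" if "z \<in> Q" for z
    using bij_betwE[OF g(1)] that by (auto simp: L_def)
  have eq: "(promotion P r ^^ m) L z = L z - m" if "z \<in> Q" for z
    using funpow_promotion_lower_order_ideal[OF P L Q(1) Lm _ that] by simp
  have "L y < L x"
    using g(2) xy by (simp add: L_def)
  \<comment> \<open>Labels on \<open>Q\<close> exceed \<open>m\<close>, so truncated subtraction of
    \<open>m\<close> keeps the inequality strict.\<close>
  then have "(promotion P r ^^ m) L y < (promotion P r ^^ m) L x"
    using eq Lm xy by (simp add: diff_less_mono less_imp_le)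
  then have "\<not> linear_extension P r ((promotion P r ^^ m) L)"
    using xy QP by (force simp: linear_extension_def not_le)
  then show ?thesis
    using L k by (auto simp: untangled_def m_def)
qed

theorem theorem2p10:
  fixes P :: "'a set" and r :: "'a rel" and n k :: nat
  assumes "finite P" and "partial_order_on P r" and "card P = n" and "k + 2 \<le> n"
  shows "(\<exists>L. untangled P r k L) \<longleftrightarrow>
         (\<exists>Q. lower_order_ideal P r Q \<and> card Q = k + 2 \<and> \<not> antichain r Q)"
  using assms untangled_imp_ideal ideal_imp_untangled by metis

end
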